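(* Let $d\ge 2$, let $v_1,\dots,v_N\in\mathbb{R}^d$ ($N\ge 1$) be distinct points, and let $p_j(x),q_j(x)\in\mathbb{C}[x_1,\dots,x_d]$, $j=1,\dots,N$, be polynomials. Let $$\gamma(t)=(r_1(t),\dots,r_d(t)),\qquad 0\le t\le 1,$$ be a complex curve in $\mathbb{C}^d$ parametrized by functions $r_j(t)=a_j(t)/b_j(t)$, $j=1,\dots,d$, where $a_j,b_j$ are entire functions of $t\in\mathbb{C}$ of finite order, with $b_j\not\equiv 0$, and let $\rho\ge 0$ denote the maximum of the orders of all the $a_j,b_j$. Assume that none of the functions $p_j(\gamma(t))$, $q_j(\gamma(t))$, $j=1,\dots,N$, vanishes identically for $t\in[0,1]$, so that the function $$\phi(t)=\sum_{j=1}^N\frac{q_j(\gamma(t))}{p_j(\gamma(t))}\,e^{-2\pi i\, v_j\cdot\gamma(t)}$$ is defined for all but finitely many points $t\in[0,1]$. Then $\phi(t)$ cannot vanish identically in $t$ unless some non-trivial linear combination (with complex coefficients) of $r_1(t),\dots,r_d(t)$ is a polynomial in $t$ of degree $\le\rho$.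
   Context: For $x,y\in\mathbb{C}^d$, $x\cdot y=x_1y_1+\cdots+x_dy_d$ (no conjugation). "Order" is the usual order of growth of an entire function. A "non-trivial" linear combination $w_1r_1+\cdots+w_dr_d$ is one with $(w_1,\dots,w_d)\ne(0,\dots,0)$. "$\phi$ vanishes identically" means $\phi(t)=0$ at all $t\in[0,1]$ where it is defined. *)

theory Defs
  imports
    "HOL-Complex_Analysis.Complex_Analysis"
    "HOL-Library.Poly_Mapping"
    "HOL-Computational_Algebra.Polynomial"
begin

text \<open>Elements of \<open>\<complex>[x\<^sub>1, \<dots>, x\<^sub>d]\<close>, with variables indexed by the finite type \<open>'d\<close>:
  finitely supported families of coefficients, indexed by exponent vectors.\<close>

type_synonym 'd cmpoly = "('d \<Rightarrow>\<^sub>0 nat) \<Rightarrow>\<^sub>0 complex"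

definition cmpoly_eval :: "'d::finite cmpoly \<Rightarrow> complex ^ 'd \<Rightarrow> complex" where
  "cmpoly_eval p x =
     (\<Sum>m \<in> Poly_Mapping.keys p.
        Poly_Mapping.lookup p m * (\<Prod>i\<in>UNIV. (x $ i) ^ Poly_Mapping.lookup m i))"

text \<open>The bilinear product on \<open>\<complex>\<^sup>d\<close>; the library's inner product on \<^typ>\<open>complex ^ 'd\<close>
  is the real part of the Hermitian one.\<close>

definition cdot :: "complex ^ 'd::finite \<Rightarrow> complex ^ 'd \<Rightarrow> complex" where
  "cdot x y = (\<Sum>i\<in>UNIV. x $ i * y $ i)"

definition cvec :: "real ^ 'd::finite \<Rightarrow> complex ^ 'd" where
  "cvec v = (\<chi> i. complex_of_real (v $ i))"

text \<open>The order of growth is the infimum of the exponents \<open>s \<ge> 0\<close> such that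
  \<open>\<bar>f z\<bar> \<le> exp (\<bar>z\<bar>\<^sup>s)\<close> for all sufficiently large \<open>\<bar>z\<bar>\<close>. It is \<open>\<infinity>\<close> if there is no such \<open>s\<close>,
  and \<open>0\<close> for constants, including the zero function.\<close>

definition growth_order :: "(complex \<Rightarrow> complex) \<Rightarrow> ereal" where
  "growth_order f =
     Inf {ereal s | s::real. s \<ge> 0 \<and>
            (\<forall>\<^sub>F z in at_infinity. norm (f z) \<le> exp (norm z powr s))}"

text \<open>The points \<open>(r\<^sub>1 t, \<dots>, r\<^sub>d t)\<close> with \<open>r\<^sub>i = a\<^sub>i / b\<^sub>i\<close>. Only values at \<open>t\<close> with
  \<open>curve_defined b t\<close> are meaningful, as division by zero yields zero in HOL.\<close>

definition curve ::
  "('d::finite \<Rightarrow> complex \<Rightarrow> complex) \<Rightarrow> ('d \<Rightarrow> complex \<Rightarrow> complex) \<Rightarrow> complex \<Rightarrow> complex ^ 'd" where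
  "curve a b t = (\<chi> i. a i t / b i t)"

definition curve_defined :: "('d::finite \<Rightarrow> complex \<Rightarrow> complex) \<Rightarrow> complex \<Rightarrow> bool" where
  "curve_defined b t \<longleftrightarrow> (\<forall>i. b i t \<noteq> 0)"

definition exp_sum ::
  "nat \<Rightarrow> (nat \<Rightarrow> real ^ 'd::finite) \<Rightarrow> (nat \<Rightarrow> 'd cmpoly) \<Rightarrow> (nat \<Rightarrow> 'd cmpoly)
     \<Rightarrow> complex ^ 'd \<Rightarrow> complex" where
  "exp_sum N v p q x =
     (\<Sum>j = 1..N. cmpoly_eval (q j) x / cmpoly_eval (p j) x
                    * exp (- 2 * complex_of_real pi * \<i> * cdot (cvec (v j)) x))"

definition exp_sum_defined :: "nat \<Rightarrow> (nat \<Rightarrow> 'd::finite cmpoly) \<Rightarrow> complex ^ 'd \<Rightarrow> bool" where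
  "exp_sum_defined N p x \<longleftrightarrow> (\<forall>j\<in>{1..N}. cmpoly_eval (p j) x \<noteq> 0)"

text \<open>\<open>g\<close> vanishes at every point of \<open>[0,1]\<close> where it is defined; \<open>D\<close> is its domain of
  definition.\<close>

definition vanishes_identically :: "(complex \<Rightarrow> bool) \<Rightarrow> (complex \<Rightarrow> complex) \<Rightarrow> bool" where
  "vanishes_identically D g \<longleftrightarrow>
     (\<forall>t::real. 0 \<le> t \<and> t \<le> 1 \<and> D (complex_of_real t) \<longrightarrow> g (complex_of_real t) = 0)"

end

theory Submission
  imports Defs "HOL-Real_Asymp.Real_Asymp"
begin

text \<open>Clearing denominators, the vanishing of \<open>\<phi>\<close> becomes \<open>\<Sum>\<^sub>j f\<^sub>j exp (A\<^sub>j / B) = 0\<close> off the zeros of \<open>B\<close>,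
  where \<open>f\<^sub>j, A\<^sub>j, B\<close> are entire of order at most \<open>\<rho>\<close> and \<open>f\<^sub>j\<close> is not identically zero. As the exponents
  themselves have finite order, differentiating and eliminating one term yields a shorter relation
  of the same kind. This must break down, since a single term cannot vanish, and it does so only
  when some coefficient becomes zero, that is, when \<open>f\<^sub>j exp (A\<^sub>j / B)\<close> is a constant multiple of
  \<open>f\<^sub>k exp (A\<^sub>k / B)\<close> for some \<open>j \<noteq> k\<close>. Then \<open>exp ((A\<^sub>j - A\<^sub>k) / B)\<close> is a quotient of entire functions of order
  at most \<open>\<rho>\<close>, so \<open>(A\<^sub>j - A\<^sub>k) / B\<close> has no poles and, as in Hadamard's theorem, is a polynomial of
  degree at most \<open>\<rho>\<close>. It equals \<open>-2\<pi>\<i> (v\<^sub>j - v\<^sub>k) \<cdot> \<gamma>\<close>.\<close>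

section \<open>Entire functions of bounded order\<close>

text \<open>Asking for a bound at every \<open>s > \<rho>\<close> leaves a margin that absorbs
  constant factors, products and shifts of the argument. For \<open>\<rho> \<ge> 0\<close> the class
  is therefore closed under the ring operations and under differentiation.\<close>

definition entire_order_le :: "real \<Rightarrow> (complex \<Rightarrow> complex) set" where
  "entire_order_le \<rho> = {f. f holomorphic_on UNIV \<and>
     (\<forall>s>\<rho>. \<forall>\<^sub>F z in at_infinity. norm (f z) \<le> exp (norm z powr s))}"

lemma entire_order_leI:
  assumes "f holomorphic_on UNIV"
    and "\<And>s. s > \<rho> \<Longrightarrow> \<forall>\<^sub>F z in at_infinity. norm (f z) \<le> exp (norm z powr s)"
  shows "f \<in> entire_order_le \<rho>"
  using assms by (simp add: entire_order_le_def)

lemma entire_order_le_holomorphic: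
  "f \<in> entire_order_le \<rho> \<Longrightarrow> f holomorphic_on S"
  unfolding entire_order_le_def using holomorphic_on_subset by blast

lemma entire_order_le_bound:
  "f \<in> entire_order_le \<rho> \<Longrightarrow> s > \<rho> \<Longrightarrow> \<forall>\<^sub>F z in at_infinity. norm (f z) \<le> exp (norm z powr s)"
  by (simp add: entire_order_le_def)

lemma eventually_at_infinity_norm:
  assumes "eventually P at_top"
  shows "\<forall>\<^sub>F z in at_infinity. P (norm (z::complex))"
  using assms filterlim_norm_at_top by (auto simp: filterlim_iff)

lemma entire_order_le_const:
  assumes "\<rho> \<ge> 0"
  shows "(\<lambda>_. c) \<in> entire_order_le \<rho>"
proof (rule entire_order_leI)
  fix s assume "s > \<rho>"
  with assms have "s > 0" by simp
  then have "\<forall>\<^sub>F x in at_top. norm c \<le> exp (x powr s)" by real_asymp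
  then show "\<forall>\<^sub>F z in at_infinity. norm c \<le> exp (norm (z::complex) powr s)"
    by (rule eventually_at_infinity_norm)
qed auto

lemma entire_order_le_add:
  assumes "\<rho> \<ge> 0" "f \<in> entire_order_le \<rho>" "g \<in> entire_order_le \<rho>"
  shows "(\<lambda>z. f z + g z) \<in> entire_order_le \<rho>"
proof (rule entire_order_leI)
  show "(\<lambda>z. f z + g z) holomorphic_on UNIV"
    using assms by (intro holomorphic_intros entire_order_le_holomorphic)
  fix s assume s: "s > \<rho>"
  \<comment> \<open>An exponent strictly between \<open>\<rho>\<close> and \<open>s\<close>: both
    functions obey the bound with \<open>r\<close>, and the gap up to \<open>s\<close> pays for the
    factor 2.\<close>
  define r where "r = (\<rho> + s) / 2"
  have r: "\<rho> < r" "0 < r" "r < s" using s assms(1) by (auto simp: r_def field_simps)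
  then have "\<forall>\<^sub>F x in at_top. 2 * exp (x powr r) \<le> exp (x powr s)" by real_asymp
  from eventually_at_infinity_norm[OF this] entire_order_le_bound[OF assms(2) r(1)]
    entire_order_le_bound[OF assms(3) r(1)]
  show "\<forall>\<^sub>F z in at_infinity. norm (f z + g z) \<le> exp (norm z powr s)"
  proof eventually_elim
    case (elim z)
    then show ?case using norm_triangle_ineq[of "f z" "g z"] by linarith
  qed
qed

lemma entire_order_le_mult:
  assumes "\<rho> \<ge> 0" "f \<in> entire_order_le \<rho>" "g \<in> entire_order_le \<rho>"
  shows "(\<lambda>z. f z * g z) \<in> entire_order_le \<rho>"
proof (rule entire_order_leI)
  show "(\<lambda>z. f z * g z) holomorphic_on UNIV"
    using assms by (intro holomorphic_intros entire_order_le_holomorphic)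
  fix s assume s: "s > \<rho>"
  define r where "r = (\<rho> + s) / 2"
  have r: "\<rho> < r" "0 < r" "r < s" using s assms(1) by (auto simp: r_def field_simps)
  then have "\<forall>\<^sub>F x in at_top. exp (x powr r) * exp (x powr r) \<le> exp (x powr s)" by real_asymp
  from eventually_at_infinity_norm[OF this] entire_order_le_bound[OF assms(2) r(1)]
    entire_order_le_bound[OF assms(3) r(1)]
  show "\<forall>\<^sub>F z in at_infinity. norm (f z * g z) \<le> exp (norm z powr s)"
  proof eventually_elim
    case (elim z)
    have "norm (f z * g z) \<le> exp (norm z powr r) * exp (norm z powr r)"
      unfolding norm_mult using elim by (intro mult_mono) auto
    then show ?case using elim by linarith
  qed
qed

lemma entire_order_le_diff:
  assumes "\<rho> \<ge> 0" "f \<in> entire_order_le \<rho>" "g \<in> entire_order_le \<rho>"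
  shows "(\<lambda>z. f z - g z) \<in> entire_order_le \<rho>"
  using entire_order_le_add[OF assms(1,2)
      entire_order_le_mult[OF assms(1) entire_order_le_const[OF assms(1), of "-1"] assms(3)]]
  by simp

lemma entire_order_le_power:
  assumes "\<rho> \<ge> 0" "f \<in> entire_order_le \<rho>"
  shows "(\<lambda>z. f z ^ n) \<in> entire_order_le \<rho>"
  by (induction n) (auto intro: assms entire_order_le_const entire_order_le_mult)

lemma entire_order_le_sum:
  assumes "\<rho> \<ge> 0" "\<And>i. i \<in> I \<Longrightarrow> f i \<in> entire_order_le \<rho>"
  shows "(\<lambda>z. \<Sum>i\<in>I. f i z) \<in> entire_order_le \<rho>"
  using assms(2)
  by (induction I rule: infinite_finite_induct)
     (auto intro: assms(1) entire_order_le_const entire_order_le_add)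

lemma entire_order_le_prod:
  assumes "\<rho> \<ge> 0" "\<And>i. i \<in> I \<Longrightarrow> f i \<in> entire_order_le \<rho>"
  shows "(\<lambda>z. \<Prod>i\<in>I. f i z) \<in> entire_order_le \<rho>"
  using assms(2)
  by (induction I rule: infinite_finite_induct)
     (auto intro: assms(1) entire_order_le_const entire_order_le_mult)

text \<open>Cauchy's estimate on a circle of radius 1 involves values of \<open>f\<close> only at
  modulus at most \<open>norm z + 1\<close>, and a slightly larger exponent absorbs that
  shift.\<close>

lemma entire_order_le_deriv:
  assumes "\<rho> \<ge> 0" "f \<in> entire_order_le \<rho>"
  shows "deriv f \<in> entire_order_le \<rho>"
proof (rule entire_order_leI)
  show "deriv f holomorphic_on UNIV"
    using assms by (intro holomorphic_intros entire_order_le_holomorphic) auto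
  fix s assume s: "s > \<rho>"
  define r where "r = (\<rho> + s) / 2"
  have r: "\<rho> < r" "0 < r" "r < s" using s assms(1) by (auto simp: r_def field_simps)
  then have ev: "\<forall>\<^sub>F x in at_top. exp ((x + 1) powr r) \<le> exp (x powr s)" by real_asymp
  obtain M where M: "\<And>z. norm z \<ge> M \<Longrightarrow> norm (f z) \<le> exp (norm z powr r)"
    using entire_order_le_bound[OF assms(2) r(1)] by (auto simp: eventually_at_infinity)
  \<comment> \<open>The extra 1 keeps the whole unit circle around \<open>z\<close> in the region
    where the growth bound on \<open>f\<close> holds.\<close>
  have "\<forall>\<^sub>F x in at_top. x \<ge> M + 1" by (rule eventually_ge_at_top)
  from eventually_at_infinity_norm[OF this] eventually_at_infinity_norm[OF ev]
  show "\<forall>\<^sub>F z in at_infinity. norm (deriv f z) \<le> exp (norm z powr s)"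
  proof eventually_elim
    case (elim z)
    have "norm ((deriv ^^ 1) f z) \<le> fact 1 * exp ((norm z + 1) powr r) / 1 ^ 1"
    proof (rule Cauchy_inequality)
      show "f holomorphic_on ball z 1" "continuous_on (cball z 1) f"
        using entire_order_le_holomorphic[OF assms(2)] holomorphic_on_imp_continuous_on by blast+
      fix w assume w: "norm (z - w) = 1"
      have "norm z \<le> norm w + 1" "norm w \<le> norm z + 1"
        using w norm_triangle_ineq2[of z w] norm_triangle_ineq2[of w z] 
        by (auto simp: norm_minus_commute)
      then have "norm (f w) \<le> exp (norm w powr r)" "norm w powr r \<le> (norm z + 1) powr r"
        using elim r by (auto intro!: M powr_mono2)
      then show "norm (f w) \<le> exp ((norm z + 1) powr r)"
        by (meson exp_le_cancel_iff order_trans)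
    qed auto
    then have "norm (deriv f z) \<le> exp ((norm z + 1) powr r)" by simp
    then show ?case using elim(2) by (rule order_trans)
  qed
qed

lemma growth_order_nonneg: "growth_order f \<ge> 0"
  unfolding growth_order_def by (rule Inf_greatest) auto

lemma entire_order_le_growth_order:
  assumes "f holomorphic_on UNIV" "growth_order f \<le> ereal \<rho>"
  shows "f \<in> entire_order_le \<rho>"
proof (rule entire_order_leI)
  fix s assume "s > \<rho>"
  then have "growth_order f < ereal s" using assms(2) by (simp add: le_less_trans)
  then obtain r where r: "r < s" "\<forall>\<^sub>F z in at_infinity. norm (f z) \<le> exp (norm z powr r)"
    unfolding growth_order_def Inf_less_iff by auto
  \<comment> \<open>\<open>powr\<close> is monotone in the exponent only for a base of at least
    1.\<close>
  have "\<forall>\<^sub>F x in at_top. x \<ge> (1::real)" by (rule eventually_ge_at_top)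
  from eventually_at_infinity_norm[OF this] r(2)
  show "\<forall>\<^sub>F z in at_infinity. norm (f z) \<le> exp (norm z powr s)"
  proof eventually_elim
    case (elim z)
    then show ?case using powr_mono[of r s "norm z"] r(1)
      by (meson exp_le_cancel_iff less_imp_le order_trans)
  qed
qed (fact assms)

section \<open>Exponentials that are quotients of functions of finite order\<close>

lemma open_nonzeros:
  fixes g :: "complex \<Rightarrow> complex"
  assumes "g holomorphic_on UNIV"
  shows "open {z. g z \<noteq> 0}"
  using assms holomorphic_on_imp_continuous_on[of g UNIV]
  by (intro open_Collect_neq) (auto intro: continuous_on_const)

text \<open>A non-constant entire function has only countably many zeros, and removing countably
  many points does not disconnect the plane.\<close>

lemma connected_nonzeros:
  assumes "g holomorphic_on UNIV" "g w \<noteq> 0"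
  shows "connected {z. g z \<noteq> 0}"
proof (cases "g constant_on UNIV")
  case True
  then have "{z. g z \<noteq> 0} = UNIV" using assms(2) by (auto simp: constant_on_def)
  then show ?thesis by (simp add: convex_connected)
next
  case False
  have "countable {z \<in> UNIV. g z = 0}"
    by (rule holomorphic_countable_zeros)
       (use assms False in \<open>auto intro: convex_connected\<close>)
  then have "connected (UNIV - {z. g z = 0})"
    by (intro connected_open_diff_countable) (auto intro: convex_connected)
  then show ?thesis by (simp add: Diff_eq Collect_neg_eq[symmetric])
qed

lemma finite_zeros_compact:
  assumes "g holomorphic_on UNIV" "g w \<noteq> 0" "compact K"
  shows "finite {z \<in> K. g z = 0}"
proof (cases "g constant_on UNIV")
  case True
  then have "{z \<in> K. g z = 0} = {}" using assms(2) by (auto simp: constant_on_def)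
  then show ?thesis by (simp only: finite.emptyI)
next
  case False
  show ?thesis
    by (rule holomorphic_compact_finite_zeros[of g UNIV])
       (use assms False in \<open>auto intro: convex_connected\<close>)
qed

text \<open>Away from \<open>w\<close> the quotient by the power of \<open>z - w\<close> is
  holomorphic, and near \<open>w\<close> it agrees with the local factor at a zero of order
  \<open>n\<close>. The case \<open>n = 0\<close> covers \<open>g w \<noteq> 0\<close>.\<close>

lemma entire_factor_zero:
  assumes "g holomorphic_on UNIV" "g u \<noteq> 0"
  obtains G n where "G holomorphic_on UNIV" "G w \<noteq> 0" "\<And>z. g z = (z - w) ^ n * G z"
proof -
  obtain r n k where r: "r > 0" "k holomorphic_on cball w r"
    "\<And>z. z \<in> cball w r \<Longrightarrow> g z = k z * (z - w) ^ n \<and> k z \<noteq> 0"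
    using zorder_exist_zero[of g UNIV w] assms convex_connected[OF convex_UNIV] by force
  define G where "G = (\<lambda>z. if z = w then k w else g z / (z - w) ^ n)"
  have "G holomorphic_on (- {w}) \<union> ball w r"
  proof (rule holomorphic_on_Un)
    have "(\<lambda>z. g z / (z - w) ^ n) holomorphic_on (- {w})"
      using assms(1) by (auto intro!: holomorphic_intros intro: holomorphic_on_subset)
    then show "G holomorphic_on (- {w})"
      by (rule holomorphic_transform) (auto simp: G_def)
    have "k holomorphic_on ball w r"
      using r(2) ball_subset_cball holomorphic_on_subset by blast
    then show "G holomorphic_on ball w r"
      by (rule holomorphic_transform) (use r(3) in \<open>auto simp: G_def\<close>)
  qed auto
  moreover have "(- {w}) \<union> ball w r = UNIV" using r(1) by auto
  ultimately have "G holomorphic_on UNIV" by simp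
  moreover have "G w \<noteq> 0" using r by (auto simp: G_def)
  moreover have "g z = (z - w) ^ n * G z" for z
    using r(1) r(3)[of w] by (cases "z = w") (auto simp: G_def)
  ultimately show ?thesis using that by blast
qed

text \<open>\<open>q\<close> is the product of \<open>(z - w) / (c - w)\<close> over the zeros \<open>w\<close> in the ball; compared with a
  Blaschke product, it is entire and tolerates zeros on the boundary.\<close>

lemma divide_out_zeros_ball:
  assumes "g holomorphic_on UNIV" "g c \<noteq> 0"
  obtains q G where "q holomorphic_on UNIV" "G holomorphic_on UNIV"
    "\<And>z. g z = q z * G z" "q c = 1" "\<And>z. z \<in> ball c R \<Longrightarrow> G z \<noteq> 0"
    "\<And>z. dist c z = 2 * R \<Longrightarrow> norm (q z) \<ge> 1"
proof -
  have "finite {z \<in> cball c R. g z = 0}"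
    using assms by (intro finite_zeros_compact) auto
  then have "finite {z \<in> ball c R. g z = 0}"
    by (rule finite_subset[rotated]) auto
  then have "\<exists>q G. q holomorphic_on UNIV \<and> G holomorphic_on UNIV \<and> (\<forall>z. g z = q z * G z) \<and> q c = 1 \<and>
     (\<forall>z \<in> ball c R. G z \<noteq> 0) \<and> (\<forall>z. dist c z = 2 * R \<longrightarrow> norm (q z) \<ge> 1)"
    using assms
  proof (induction "{z \<in> ball c R. g z = 0}" arbitrary: g rule: finite_induct)
    case empty
    then show ?case by (intro exI[of _ "\<lambda>_. 1"] exI[of _ g]) auto
  next
    case (insert w Z)
    from insert.hyps(4) have w: "w \<in> ball c R" "g w = 0" by auto
    then have wc: "w \<noteq> c" using insert.prems by auto
    obtain G n where G: "G holomorphic_on UNIV" "G w \<noteq> 0" "\<And>z. g z = (z - w) ^ n * G z"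
      using entire_factor_zero[OF insert.prems] by blast
    \<comment> \<open>\<open>k\<close> is \<open>g\<close> without its zero at \<open>w\<close>,
      scaled so that the factor split off, \<open>((z - w) / (c - w)) ^ n\<close>, has value 1 at
      \<open>c\<close>.\<close>
    define k where "k = (\<lambda>z. (c - w) ^ n * G z)"
    have "Z = {z \<in> ball c R. k z = 0}"
    proof -
      have "Z = {z \<in> ball c R. g z = 0} - {w}" using insert.hyps(2,4) by auto
      then show ?thesis using G wc by (auto simp: k_def)
    qed
    moreover have "k holomorphic_on UNIV" unfolding k_def by (intro holomorphic_intros G)
    moreover have "k c \<noteq> 0" using G(3)[of c] insert.prems(2) by (auto simp: k_def)
    ultimately obtain q H where q: "q holomorphic_on UNIV" "H holomorphic_on UNIV"
       "\<forall>z. k z = q z * H z" "q c = 1" "\<forall>z \<in> ball c R. H z \<noteq> 0"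
       "\<forall>z. dist c z = 2 * R \<longrightarrow> norm (q z) \<ge> 1"
      using insert.hyps(3)[of k] by blast
    have "g z = ((z - w) / (c - w)) ^ n * q z * H z" for z
    proof -
      have "g z = ((z - w) / (c - w)) ^ n * k z"
        using wc by (simp add: G(3)[of z] k_def power_divide)
      then show ?thesis using q(3) by simp
    qed
    moreover have "norm (((z - w) / (c - w)) ^ n * q z) \<ge> 1" if z: "dist c z = 2 * R" for z
    proof -
      \<comment> \<open>This is why the radius is \<open>2 * R\<close>: a point \<open>z\<close> on
        that circle is farther than \<open>R\<close> from \<open>w\<close>, while \<open>c\<close>
        is closer than \<open>R\<close> to it.\<close>
      have "dist c z \<le> dist c w + dist w z" by (rule dist_triangle)
      moreover have "dist c w < R" using w(1) by simp
      ultimately have "norm (c - w) \<le> norm (z - w)"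
        using z by (simp add: dist_norm norm_minus_commute)
      then have "norm ((z - w) / (c - w)) \<ge> 1" using wc by (simp add: norm_divide)
      then have "1 \<le> norm ((z - w) / (c - w)) ^ n" by (rule one_le_power)
      moreover have "1 \<le> norm (q z)" using q(6) z by blast
      ultimately have "1 * 1 \<le> norm ((z - w) / (c - w)) ^ n * norm (q z)"
        by (intro mult_mono) auto
      then show ?thesis by (simp add: norm_mult norm_power)
    qed
    ultimately show ?case using q wc
      by (intro exI[of _ "\<lambda>z. ((z - w) / (c - w)) ^ n * q z"] exI[of _ H])
         (auto intro!: holomorphic_intros)
  qed
  then show ?thesis using that by blast
qed

section \<open>Borel-Caratheodory estimates and the degree bound\<close>

text \<open>Rescale to the unit disc with \<open>g 0 = 0\<close>. From \<open>Re (g u) < M\<close>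
  it follows that \<open>g u\<close> is closer to 0 than to \<open>2 * M\<close>, so
  \<open>g / (2 * M - g)\<close> maps the disc into itself and Schwarz's lemma applies. At
  \<open>norm u \<le> 1 / 2\<close> it gives
  \<open>norm (g u) \<le> (2 * M + norm (g u)) / 2\<close>, which is solved for
  \<open>norm (g u)\<close>.\<close>

lemma Borel_Caratheodory_half:
  assumes holo: "f holomorphic_on ball c R" and R: "R > 0"
    and bd: "\<And>z. z \<in> ball c R \<Longrightarrow> Re (f z) < A" and z: "dist c z \<le> R / 2"
  shows "norm (f z - f c) \<le> 2 * (A - Re (f c))"
proof -
  define M where "M = A - Re (f c)"
  have M: "M > 0" using bd[of c] R by (simp add: M_def)
  define g where "g = (\<lambda>u. f (c + of_real R * u) - f c)"
  have inball: "c + of_real R * u \<in> ball c R" if "norm u < 1" for u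
    using that R by (simp add: dist_norm norm_mult)
  have holg: "g holomorphic_on ball 0 1"
  proof -
    have "f \<circ> (\<lambda>u. c + of_real R * u) holomorphic_on ball 0 1"
      by (rule holomorphic_on_compose_gen[OF _ holo]) (auto intro!: holomorphic_intros inball)
    then show ?thesis unfolding g_def by (intro holomorphic_intros) (simp add: o_def)
  qed
  have Reg: "Re (g u) < M" if "norm u < 1" for u
    using bd[OF inball[OF that]] by (simp add: g_def M_def)
  have less: "norm (g u) < norm (2 * of_real M - g u)" if "norm u < 1" for u
  proof -
    have "norm (2 * of_real M - g u) ^ 2 - norm (g u) ^ 2 = 4 * M * (M - Re (g u))"
      unfolding cmod_power2 by (simp add: power2_eq_square algebra_simps)
    also have "\<dots> > 0" using M Reg[OF that] by simp
    finally show ?thesis using power2_less_imp_less by fastforce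
  qed
  define u where "u = (z - c) / of_real R"
  have u: "norm u \<le> 1 / 2" "c + of_real R * u = z"
    using z R by (auto simp: u_def norm_divide dist_norm norm_minus_commute field_simps)
  have "norm (g u / (2 * of_real M - g u)) \<le> norm u"
  proof (rule Schwarz_Lemma(1))
    show "(\<lambda>u. g u / (2 * of_real M - g u)) holomorphic_on ball 0 1"
      using less by (intro holomorphic_intros holg) force
    show "norm (g u / (2 * of_real M - g u)) < 1" if "norm u < 1" for u
    proof -
      have "norm (2 * of_real M - g u) > 0" using less[OF that] norm_ge_zero le_less_trans by blast
      then show ?thesis using less[OF that] by (simp add: norm_divide)
    qed
  qed (use u in \<open>auto simp: g_def\<close>)
  moreover have "norm (2 * of_real M - g u) > 0"
    using less[of u] u norm_ge_zero le_less_trans by fastforce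
  ultimately have "norm (g u) \<le> norm u * norm (2 * of_real M - g u)"
    by (simp add: norm_divide field_simps)
  also have "\<dots> \<le> 1 / 2 * (2 * M + norm (g u))"
    using u(1) norm_triangle_ineq4[of "2 * of_real M" "g u"] M
    by (intro mult_mono) (auto simp: norm_mult)
  finally show ?thesis using u by (simp add: g_def M_def)
qed

text \<open>Cauchy's estimate on the disc of radius \<open>R / 2\<close>, where the previous lemma
  controls \<open>f - f c\<close>.\<close>

lemma Borel_Caratheodory_deriv:
  assumes holo: "f holomorphic_on ball c R" and R: "R > 0" and n: "n > 0"
    and bd: "\<And>z. z \<in> ball c R \<Longrightarrow> Re (f z) < A"
  shows "norm ((deriv ^^ n) f c) \<le> fact n * (3 * (A - Re (f c))) / (R / 2) ^ n"
proof (rule Cauchy_higher_deriv_bound[where y = "f c"])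
  have sub: "cball c (R / 2) \<subseteq> ball c R" using R by auto
  show "f holomorphic_on ball c (R / 2)"
    using holo by (rule holomorphic_on_subset) (use R in auto)
  show "continuous_on (cball c (R / 2)) f"
    using holo sub holomorphic_on_imp_continuous_on continuous_on_subset by blast
  fix z assume "z \<in> ball c (R / 2)"
  then have "norm (f z - f c) \<le> 2 * (A - Re (f c))"
    by (intro Borel_Caratheodory_half[OF holo R bd]) auto
  \<comment> \<open>The Cauchy estimate asks for values in an open ball, so the constant 2 is
    enlarged to 3.\<close>
  also have "\<dots> < 3 * (A - Re (f c))" using bd[of c] R by simp
  finally show "f z \<in> ball (f c) (3 * (A - Re (f c)))" by (simp add: dist_norm norm_minus_commute)
qed (use R n in auto)

text \<open>Since \<open>f\<close> and \<open>g\<close> have the same zeros, dividing both by the same \<open>q\<close> leaves functions without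
  zeros in \<open>ball c R\<close>, whose logarithms have real part at most \<open>(3 * R) powr s\<close>. Their difference is
  \<open>h\<close>, so its \<open>n\<close>-th Taylor coefficient is \<open>O(R powr (s - n))\<close>. No lower bound for \<open>\<bar>g\<bar>\<close> is required.\<close>

lemma finite_order_exp_deriv_eq_0:
  assumes f: "f \<in> entire_order_le \<rho>" and g: "g \<in> entire_order_le \<rho>" and h: "h holomorphic_on UNIV"
    and \<rho>: "\<rho> \<ge> 0" and gc: "g c \<noteq> 0" and eq: "\<And>z. f z = g z * exp (h z)" and n: "real n > \<rho>"
  shows "(deriv ^^ n) h c = 0"
proof -
  \<comment> \<open>\<open>s > \<rho>\<close> gives the growth bounds on \<open>f\<close> and
    \<open>g\<close>; \<open>s < n\<close> makes \<open>T R\<close> tend to 0.\<close>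
  define s where "s = (\<rho> + real n) / 2"
  have s: "\<rho> < s" "s < real n" "0 < s" using n \<rho> by (auto simp: s_def field_simps)
  have n0: "n > 0" using n \<rho> by auto
  have fc: "f c \<noteq> 0" using gc eq by simp
  obtain M1 where M1: "\<And>z. norm z \<ge> M1 \<Longrightarrow> norm (f z) \<le> exp (norm z powr s)"
    using entire_order_le_bound[OF f s(1)] by (auto simp: eventually_at_infinity)
  obtain M2 where M2: "\<And>z. norm z \<ge> M2 \<Longrightarrow> norm (g z) \<le> exp (norm z powr s)"
    using entire_order_le_bound[OF g s(1)] by (auto simp: eventually_at_infinity)
  define T where "T = (\<lambda>R. fact n * (3 * (2 * ((3 * R) powr s + 1) - ln (norm (f c)) - ln (norm (g c)))) / (R / 2) ^ n)"
  have bound: "norm ((deriv ^^ n) h c) \<le> T R" if R: "R > 0" "R \<ge> norm c" "R \<ge> M1" "R \<ge> M2" for R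
  proof -
    define K where "K = (3 * R) powr s"
    obtain q G where q: "q holomorphic_on UNIV" "G holomorphic_on UNIV"
      "\<And>z. g z = q z * G z" "q c = 1" "\<And>z. z \<in> ball c R \<Longrightarrow> G z \<noteq> 0"
      "\<And>z. dist c z = 2 * R \<Longrightarrow> norm (q z) \<ge> 1"
      using divide_out_zeros_ball[OF entire_order_le_holomorphic[OF g] gc] by metis
    define F where "F = (\<lambda>z. G z * exp (h z))"
    have holF: "F holomorphic_on UNIV" unfolding F_def by (intro holomorphic_intros q h)
    have fF: "f z = q z * F z" for z by (simp add: eq q(3) F_def)
    \<comment> \<open>Maximum modulus on the disc of radius \<open>2 * R\<close>: on its boundary
      \<open>norm (q z) \<ge> 1\<close>, so a bound for \<open>q * k\<close> there bounds
      \<open>k\<close>. It is applied to \<open>G\<close>, where the product is \<open>g\<close>,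
      and to \<open>F\<close>, where it is \<open>f\<close>.\<close>
    have quot: "norm (k z) \<le> exp K" if k: "k holomorphic_on UNIV" and z: "z \<in> ball c R"
      and b: "\<And>z. norm z \<ge> R \<Longrightarrow> norm (q z * k z) \<le> exp (norm z powr s)" for k z
    proof (rule maximum_modulus_frontier[of k "ball c (2 * R)"])
      show "k holomorphic_on interior (ball c (2 * R))" "continuous_on (closure (ball c (2 * R))) k"
        using k holomorphic_on_subset holomorphic_on_imp_continuous_on continuous_on_subset
        by blast+
      show "z \<in> ball c (2 * R)" using z R by simp
      fix w assume "w \<in> frontier (ball c (2 * R))"
      then have w: "dist c w = 2 * R" using R by (simp add: frontier_ball)
      \<comment> \<open>Since \<open>norm c \<le> R\<close>, the circle of radius
        \<open>2 * R\<close> around \<open>c\<close> stays between the moduli \<open>R\<close> and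
        \<open>3 * R\<close>.\<close>
      then have nw: "norm w \<ge> R" "norm w \<le> 3 * R"
        using R norm_triangle_ineq2[of c w] norm_triangle_ineq2[of w c] norm_triangle_ineq4[of c w]
        by (auto simp: dist_norm norm_minus_commute)
      have "1 * norm (k w) \<le> norm (q w) * norm (k w)"
        using q(6)[OF w] by (intro mult_right_mono) auto
      also have "\<dots> \<le> exp (norm w powr s)" using b[OF nw(1)] by (simp add: norm_mult)
      also have "\<dots> \<le> exp K" using nw R s by (auto simp: K_def intro!: powr_mono2)
      finally show "norm (k w) \<le> exp K" by simp
    qed (use R in auto)
    have Gle: "norm (G z) \<le> exp K" if "z \<in> ball c R" for z
      using that R by (intro quot q) (auto simp: q(3)[symmetric] intro!: M2)
    have Fle: "norm (F z) \<le> exp K" if "z \<in> ball c R" for z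
      using that R by (intro quot holF) (auto simp: fF[symmetric] intro!: M1)
    obtain \<psi> where \<psi>: "\<psi> holomorphic_on ball c R" "\<And>z. z \<in> ball c R \<Longrightarrow> exp (\<psi> z) = G z"
      using holomorphic_logarithm_exists[of "ball c R" G c] q R
      by (metis centre_in_ball convex_ball holomorphic_on_subset open_ball top_greatest)
    define \<phi> where "\<phi> = (\<lambda>z. \<psi> z + h z)"
    have hb: "h holomorphic_on ball c R" using h holomorphic_on_subset by blast
    have \<phi>: "\<phi> holomorphic_on ball c R" unfolding \<phi>_def by (intro holomorphic_intros \<psi> hb)
    have e\<phi>: "exp (\<phi> z) = F z" if "z \<in> ball c R" for z
      using \<psi>(2)[OF that] by (simp add: \<phi>_def F_def exp_add)
    have Re\<psi>: "Re (\<psi> z) < K + 1" if "z \<in> ball c R" for z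
      using Gle[OF that] by (simp flip: \<psi>(2)[OF that])
    have Re\<phi>: "Re (\<phi> z) < K + 1" if "z \<in> ball c R" for z
      using Fle[OF that] by (simp flip: e\<phi>[OF that])
    have c: "c \<in> ball c R" using R by simp
    \<comment> \<open>Because \<open>q c = 1\<close>, these two constants do not depend on
      \<open>R\<close>, although \<open>q\<close>, \<open>G\<close> and \<open>F\<close> do.\<close>
    have Rec: "Re (\<psi> c) = ln (norm (g c))" "Re (\<phi> c) = ln (norm (f c))"
      using q(3)[of c] q(4) fF[of c] by (simp_all flip: \<psi>(2)[OF c] e\<phi>[OF c])
    have "h z = \<phi> z - \<psi> z" for z by (simp add: \<phi>_def)
    then have "(deriv ^^ n) h c = (deriv ^^ n) (\<lambda>z. \<phi> z - \<psi> z) c" by presburger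
    also have "\<dots> = (deriv ^^ n) \<phi> c - (deriv ^^ n) \<psi> c"
      by (rule higher_deriv_diff[OF \<phi> \<psi>(1)]) (use c in auto)
    finally have "norm ((deriv ^^ n) h c) \<le> norm ((deriv ^^ n) \<phi> c) + norm ((deriv ^^ n) \<psi> c)"
      using norm_triangle_ineq4 by metis
    also have "\<dots> \<le> fact n * (3 * (K + 1 - Re (\<phi> c))) / (R / 2) ^ n
                   + fact n * (3 * (K + 1 - Re (\<psi> c))) / (R / 2) ^ n"
      using R n0 Re\<phi> Re\<psi> \<phi> \<psi>(1) by (intro add_mono Borel_Caratheodory_deriv) auto
    also have "\<dots> = T R"
      unfolding T_def Rec K_def[symmetric] by (simp add: add_divide_distrib[symmetric] algebra_simps)
    finally show ?thesis .
  qed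
  have "(T \<longlongrightarrow> 0) at_top"
    using s n0 unfolding T_def by real_asymp
  moreover have "\<forall>\<^sub>F R in at_top. norm ((deriv ^^ n) h c) \<le> T R"
    using eventually_ge_at_top[of "max 1 (max (norm c) (max M1 M2))"]
    by eventually_elim (auto intro!: bound)
  ultimately have "norm ((deriv ^^ n) h c) \<le> 0"
    by (intro tendsto_lowerbound) auto
  then show ?thesis by simp
qed

text \<open>All derivatives of \<open>h\<close> at \<open>c\<close> of order above
  \<open>\<rho>\<close> vanish, so the Taylor series at \<open>c\<close> stops at the integer part
  of \<open>\<rho>\<close>.\<close>

lemma entire_quotient_exp_polynomial:
  assumes f: "f \<in> entire_order_le \<rho>" and g: "g \<in> entire_order_le \<rho>" and h: "h holomorphic_on UNIV"
    and \<rho>: "\<rho> \<ge> 0" and gc: "g c \<noteq> 0" and eq: "\<And>z. f z = g z * exp (h z)"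
  obtains P where "real (degree P) \<le> \<rho>" "\<And>z. h z = poly P z"
proof -
  define d where "d = nat \<lfloor>\<rho>\<rfloor>"
  have d: "real d \<le> \<rho>" "\<And>n. n > d \<Longrightarrow> real n > \<rho>" using \<rho> unfolding d_def by linarith+
  define P where "P = (\<Sum>k\<le>d. smult ((deriv ^^ k) h c / fact k) ([:-c, 1:] ^ k))"
  have "degree P \<le> d"
    unfolding P_def
    by (intro degree_sum_le) (auto intro!: order_trans[OF degree_smult_le] simp: degree_linear_power)
  then have "real (degree P) \<le> \<rho>" using d(1) by linarith
  moreover have "h z = poly P z" for z
  proof -
    have "(\<lambda>n. (deriv ^^ n) h c / fact n * (z - c) ^ n) sums h z"
      by (rule holomorphic_power_series[of h c "dist c z + 1"]) (use h holomorphic_on_subset in auto)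
    moreover have "(\<lambda>n. (deriv ^^ n) h c / fact n * (z - c) ^ n) sums
        (\<Sum>n\<le>d. (deriv ^^ n) h c / fact n * (z - c) ^ n)"
      by (rule sums_finite) (use d finite_order_exp_deriv_eq_0[OF f g h \<rho> gc eq] in auto)
    ultimately have "h z = (\<Sum>n\<le>d. (deriv ^^ n) h c / fact n * (z - c) ^ n)"
      by (rule sums_unique2)
    also have "\<dots> = poly P z" by (simp add: P_def poly_sum)
    finally show ?thesis .
  qed
  ultimately show ?thesis using that by blast
qed

section \<open>Identity theorem and removable singularities\<close>

text \<open>If the product vanished everywhere, \<open>f\<close> would be zero on the nonempty open
  set where \<open>g\<close> is not, hence everywhere.\<close>

lemma nonzero_entire_mult:
  assumes "f holomorphic_on UNIV" "g holomorphic_on UNIV" "f u \<noteq> 0" "g v \<noteq> 0"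
  shows "\<exists>z::complex. f z * g z \<noteq> 0"
proof (rule ccontr)
  assume contr: "\<not> ?thesis"
  have "f u = 0"
  proof (rule analytic_continuation_open[where f = f and g = "\<lambda>_. 0" and s = "{z. g z \<noteq> 0}"])
    show "open {z. g z \<noteq> 0}" by (rule open_nonzeros[OF assms(2)])
    show "{z. g z \<noteq> 0} \<noteq> {}" using assms(4) by blast
    show "f z = 0" if "z \<in> {z. g z \<noteq> 0}" for z using that contr by auto
  qed (use assms(1) in \<open>auto intro: convex_connected\<close>)
  then show False using assms(3) by simp
qed

lemma nonzero_entire_prod:
  assumes "finite I" "\<And>i. i \<in> I \<Longrightarrow> f i holomorphic_on UNIV" "\<And>i. i \<in> I \<Longrightarrow> \<exists>z. f i z \<noteq> 0"
  shows "\<exists>z::complex. (\<Prod>i\<in>I. f i z) \<noteq> 0"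
  using assms
proof (induction I rule: finite_induct)
  case (insert i I)
  have hol: "f i holomorphic_on UNIV" "(\<lambda>z. \<Prod>i\<in>I. f i z) holomorphic_on UNIV"
    using insert.prems(1) by (auto intro: holomorphic_on_prod)
  obtain u where u: "f i u \<noteq> 0" using insert.prems(2) by blast
  obtain v where "(\<Prod>i\<in>I. f i v) \<noteq> 0" using insert.IH insert.prems by blast
  from nonzero_entire_mult[OF hol u this] show ?case
    using insert.hyps by simp
qed auto

text \<open>The identity theorem on the open set where \<open>k\<close> is nonzero; it carries
  identities obtained by division over to the zeros of the denominator.\<close>

lemma entire_eq_off_zeros:
  assumes "f holomorphic_on UNIV" "g holomorphic_on UNIV" "k holomorphic_on UNIV" "k u \<noteq> 0"
    and "\<And>z. k z \<noteq> 0 \<Longrightarrow> f z = g z"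
  shows "f z = g (z::complex)"
proof (rule analytic_continuation_open[where f = f and g = g and s = "{z. k z \<noteq> 0}"])
  show "open {z. k z \<noteq> 0}" by (rule open_nonzeros[OF assms(3)])
  show "{z. k z \<noteq> 0} \<noteq> {}" using assms(4) by blast
qed (use assms in \<open>auto intro: convex_connected\<close>)

text \<open>If \<open>exp h\<close> is meromorphic at \<open>c\<close> then, after splitting off a holomorphic logarithm,
  \<open>exp h\<close> is a power of \<open>z - c\<close>; the exponent is the residue of a derivative, hence zero.\<close>

lemma exp_meromorphic_imp_limit:
  assumes h: "h holomorphic_on ball c r - {c}" and r: "r > 0"
    and f: "f holomorphic_on UNIV" "f u \<noteq> 0" and g: "g holomorphic_on UNIV" "g v \<noteq> 0"
    and eq: "\<And>z. z \<in> ball c r - {c} \<Longrightarrow> f z * exp (h z) = g z"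
  shows "\<exists>l. (h \<longlongrightarrow> l) (at c)"
proof -
  obtain F m where F: "F holomorphic_on UNIV" "F c \<noteq> 0" "\<And>z. f z = (z - c) ^ m * F z"
    using entire_factor_zero[OF f] by blast
  obtain G n where G: "G holomorphic_on UNIV" "G c \<noteq> 0" "\<And>z. g z = (z - c) ^ n * G z"
    using entire_factor_zero[OF g] by blast
  have "open ({z. F z \<noteq> 0} \<inter> {z. G z \<noteq> 0} \<inter> ball c r)"
    using F G by (intro open_Int open_nonzeros) auto
  moreover have "c \<in> {z. F z \<noteq> 0} \<inter> {z. G z \<noteq> 0} \<inter> ball c r" using F G r by auto
  ultimately obtain e where e: "e > 0" "ball c e \<subseteq> {z. F z \<noteq> 0} \<inter> {z. G z \<noteq> 0} \<inter> ball c r"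
    using open_contains_ball_eq by blast
  have "(\<lambda>z. G z / F z) holomorphic_on ball c e"
    using e F G by (intro holomorphic_intros) (auto intro: holomorphic_on_subset)
  moreover have "G z / F z \<noteq> 0" if "z \<in> ball c e" for z using e that by auto
  moreover have "c \<in> ball c e" using e by simp
  ultimately obtain \<omega> where \<omega>: "\<omega> holomorphic_on ball c e"
      "\<And>z. z \<in> ball c e \<Longrightarrow> exp (\<omega> z) = G z / F z"
    using holomorphic_logarithm_exists[OF convex_ball open_ball] by (smt (verit))
  define \<eta> where "\<eta> = (\<lambda>z. h z - \<omega> z)"
  let ?D = "ball c e - {c}"
  have hol\<eta>: "\<eta> holomorphic_on ?D"
    unfolding \<eta>_def using h \<omega> e
    by (intro holomorphic_intros) (auto intro: holomorphic_on_subset)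
  have pow: "(z - c) ^ m * exp (\<eta> z) = (z - c) ^ n" if z: "z \<in> ?D" for z
  proof -
    have nz: "F z \<noteq> 0" "G z \<noteq> 0" "z \<in> ball c r - {c}" using e z by auto
    have "(z - c) ^ m * F z * exp (h z) = (z - c) ^ n * G z"
      using eq[OF nz(3)] by (simp add: F(3) G(3))
    moreover have "exp (\<eta> z) = exp (h z) * F z / G z"
      using \<omega>(2)[of z] z by (simp add: \<eta>_def exp_diff)
    ultimately have "(z - c) ^ m * exp (\<eta> z) = (z - c) ^ n * G z / G z"
      by (metis (no_types, lifting) mult.assoc mult.commute times_divide_eq_right)
    then show ?thesis using nz by simp
  qed
  have der: "(\<eta> has_field_derivative (of_nat n - of_nat m) * (1 / (z - c))) (at z)" if z: "z \<in> ?D" for z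
  proof -
    have d1: "(\<eta> has_field_derivative deriv \<eta> z) (at z)"
      using hol\<eta> z by (intro holomorphic_derivI[of _ ?D]) auto
    have dpow: "((\<lambda>z. (z - c) ^ k) has_field_derivative of_nat k * (z - c) ^ (k - 1)) (at z)" for k
      by (auto intro!: derivative_eq_intros)
    have "((\<lambda>z. (z - c) ^ m * exp (\<eta> z)) has_field_derivative
        of_nat m * (z - c) ^ (m - 1) * exp (\<eta> z) + exp (\<eta> z) * deriv \<eta> z * (z - c) ^ m) (at z)"
      by (intro DERIV_mult dpow DERIV_fun_exp d1)
    also have "of_nat m * (z - c) ^ (m - 1) * exp (\<eta> z) + exp (\<eta> z) * deriv \<eta> z * (z - c) ^ m
      = (of_nat m * (z - c) ^ (m - 1) + (z - c) ^ m * deriv \<eta> z) * exp (\<eta> z)"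
      by (simp only: ring_distribs mult_ac)
    finally have "((\<lambda>z. (z - c) ^ n) has_field_derivative
        (of_nat m * (z - c) ^ (m - 1) + (z - c) ^ m * deriv \<eta> z) * exp (\<eta> z)) (at z)"
      by (rule has_field_derivative_transform_within_open[of _ _ _ ?D]) (use z pow in auto)
    then have "(of_nat m * (z - c) ^ (m - 1) + (z - c) ^ m * deriv \<eta> z) * exp (\<eta> z)
        = of_nat n * (z - c) ^ (n - 1)"
      by (rule DERIV_unique) (rule dpow)
    \<comment> \<open>Multiplying by \<open>z - c\<close> turns the exponents \<open>m - 1\<close>
      and \<open>n - 1\<close> into \<open>m\<close> and \<open>n\<close>. If one of them is 0, the
      truncated difference is harmless because of the factor \<open>of_nat 0\<close>.\<close>
    then have "(z - c) * ((of_nat m * (z - c) ^ (m - 1) + (z - c) ^ m * deriv \<eta> z) * exp (\<eta> z))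
        = of_nat n * (z - c) ^ n"
      by (cases n) auto
    moreover have "(z - c) * (of_nat m * (z - c) ^ (m - 1)) = of_nat m * (z - c) ^ m"
      by (cases m) auto
    moreover have "(z - c) * ((of_nat m * (z - c) ^ (m - 1) + (z - c) ^ m * deriv \<eta> z) * exp (\<eta> z))
        = (z - c) * (of_nat m * (z - c) ^ (m - 1)) * exp (\<eta> z)
          + (z - c) * deriv \<eta> z * ((z - c) ^ m * exp (\<eta> z))"
      by (simp only: distrib_left distrib_right mult_ac)
    ultimately have "of_nat m * ((z - c) ^ m * exp (\<eta> z))
        + (z - c) * deriv \<eta> z * ((z - c) ^ m * exp (\<eta> z)) = of_nat n * (z - c) ^ n"
      by (simp only: mult.assoc)
    then have "(of_nat m + (z - c) * deriv \<eta> z) * (z - c) ^ n = of_nat n * (z - c) ^ n"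
      unfolding pow[OF z] by (simp only: distrib_right)
    then have "of_nat m + (z - c) * deriv \<eta> z = of_nat n" using z by simp
    then have "deriv \<eta> z = (of_nat n - of_nat m) * (1 / (z - c))" using z
      by (metis DiffE add_diff_cancel_left' insertI1 nonzero_mult_div_cancel_left right_minus_eq
          times_divide_eq_right mult.right_neutral)
    then show ?thesis using d1 by simp
  qed
  \<comment> \<open>A derivative integrates to 0 around a closed circle, whereas
    \<open>1 / (z - c)\<close> integrates to \<open>2 * pi * \<i>\<close>; hence
    \<open>n = m\<close>.\<close>
  have "((\<lambda>z. (of_nat n - of_nat m) * (1 / (z - c))) has_contour_integral 0) (circlepath c (e / 2))"
  proof -
    have "((\<lambda>z. (of_nat n - of_nat m) * (1 / (z - c))) has_contour_integral
       (\<eta> (pathfinish (circlepath c (e / 2))) - \<eta> (pathstart (circlepath c (e / 2))))) (circlepath c (e / 2))"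
      by (rule contour_integral_primitive[of ?D]) (use der e in \<open>auto intro: has_field_derivative_at_within\<close>)
    then show ?thesis by simp
  qed
  then have "contour_integral (circlepath c (e / 2)) (\<lambda>z. (of_nat n - of_nat m) * (1 / (z - c))) = 0"
    by (rule contour_integral_unique)
  moreover have "(\<lambda>z. 1 / (z - c)) contour_integrable_on circlepath c (e / 2)"
    by (rule contour_integrable_continuous_circlepath) (use e in \<open>auto intro!: continuous_intros\<close>)
  ultimately have "(of_nat n - of_nat m) * contour_integral (circlepath c (e / 2)) (\<lambda>z. 1 / (z - c)) = 0"
    by (simp only: contour_integral_lmul)
  then have "n = m" using contour_integral_circlepath[of "e / 2" c] e by simp
  with der have "(\<eta> has_field_derivative 0) (at z)" if "z \<in> ?D" for z
    using that by simp
  moreover have "connected ?D" by (rule connected_punctured_ball) simp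
  ultimately have "\<eta> constant_on ?D"
    by (intro has_field_derivative_0_imp_constant_on) auto
  then obtain k where k: "\<And>z. z \<in> ?D \<Longrightarrow> \<eta> z = k" by (auto simp: constant_on_def)
  have "isCont \<omega> c"
    using \<omega>(1) e by (meson centre_in_ball continuous_on_eq_continuous_at holomorphic_on_imp_continuous_on open_ball)
  then have "((\<lambda>z. \<omega> z + k) \<longlongrightarrow> \<omega> c + k) (at c)"
    by (intro tendsto_intros) (simp add: isCont_def)
  moreover have "\<forall>\<^sub>F z in at c. \<omega> z + k = h z"
  proof -
    have "\<forall>\<^sub>F z in at c. z \<in> ?D" using e by (intro eventually_at_in_open) auto
    then show ?thesis by eventually_elim (use k in \<open>auto simp: \<eta>_def algebra_simps\<close>)
  qed
  ultimately have "(h \<longlongrightarrow> \<omega> c + k) (at c)"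
    by (rule Lim_transform_eventually)
  then show ?thesis ..
qed

text \<open>Zeros of \<open>B\<close> are isolated, and around each of them
  \<open>exp (A / B)\<close> agrees with the meromorphic \<open>g / f\<close>, so
  \<open>A / B\<close> has a finite limit there. \<open>remove_sings\<close> inserts these limits in
  place of the value 0 that division by zero yields.\<close>

lemma entire_extension_of_log_quotient:
  assumes A: "A holomorphic_on UNIV" and B: "B holomorphic_on UNIV" "B w \<noteq> 0"
    and f: "f holomorphic_on UNIV" "f u \<noteq> 0" and g: "g holomorphic_on UNIV" "g v \<noteq> 0"
    and eq: "\<And>z. B z \<noteq> 0 \<Longrightarrow> f z * exp (A z / B z) = g z"
  obtains H where "H holomorphic_on UNIV" "\<And>z. B z \<noteq> 0 \<Longrightarrow> H z = A z / B z"
proof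
  define h where "h = (\<lambda>z. A z / B z)"
  have hol: "h holomorphic_on S" if "\<And>z. z \<in> S \<Longrightarrow> B z \<noteq> 0" for S
    unfolding h_def using that by (intro holomorphic_intros holomorphic_on_subset[OF A]
        holomorphic_on_subset[OF B(1)]) auto
  have "remove_sings h analytic_on {c}" for c
  proof -
    obtain K n where K: "K holomorphic_on UNIV" "K c \<noteq> 0" "\<And>z. B z = (z - c) ^ n * K z"
      using entire_factor_zero[OF B] by blast
    obtain r where r: "r > 0" "ball c r \<subseteq> {z. K z \<noteq> 0}"
      using open_nonzeros[OF K(1)] K(2) open_contains_ball_eq by blast
    have nz: "B z \<noteq> 0" if "z \<in> ball c r - {c}" for z using that r K(3)[of z] by auto
    have holr: "h holomorphic_on ball c r - {c}" by (rule hol) (rule nz)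
    then obtain l where "(h \<longlongrightarrow> l) (at c)"
      using exp_meromorphic_imp_limit[OF holr r(1) f g] eq nz by (auto simp: h_def)
    moreover have "isolated_singularity_at h c"
      unfolding isolated_singularity_at_def using holr r(1)
      by (intro exI[of _ r]) (simp add: analytic_on_open open_delete)
    ultimately show ?thesis by (rule remove_sings_analytic_at[rotated])
  qed
  then have "remove_sings h analytic_on UNIV" using analytic_on_analytic_at by blast
  then show "remove_sings h holomorphic_on UNIV" by (rule analytic_imp_holomorphic)
  fix z assume z: "B z \<noteq> 0"
  have "h analytic_on {z. B z \<noteq> 0}"
    using hol[of "{z. B z \<noteq> 0}"] open_nonzeros[OF B(1)] by (simp add: analytic_on_open)
  then have "h analytic_on {z}" using z by (auto intro: analytic_on_subset)
  then show "remove_sings h z = A z / B z" by (simp add: h_def)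
qed

text \<open>The hypothesis \<open>wronskian\<close> says that \<open>f / g * exp (A / B)\<close> has derivative zero.\<close>

lemma quotient_polynomial_of_constant_exp_ratio:
  assumes \<rho>: "\<rho> \<ge> 0" and A: "A \<in> entire_order_le \<rho>" and B: "B \<in> entire_order_le \<rho>" "B w \<noteq> 0"
    and f: "f \<in> entire_order_le \<rho>" "f u \<noteq> 0" and g: "g \<in> entire_order_le \<rho>" "g v \<noteq> 0"
    and wronskian: "\<And>z. g z * (deriv f z * B z ^ 2 + f z * (deriv A z * B z - A z * deriv B z))
                         = f z * (deriv g z * B z ^ 2)"
  obtains P where "real (degree P) \<le> \<rho>" "\<And>z. A z = poly P z * B z"
proof -
  have hol: "A holomorphic_on UNIV" "B holomorphic_on UNIV" "f holomorphic_on UNIV" "g holomorphic_on UNIV"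
    using A B f g entire_order_le_holomorphic by blast+
  have der: "(k has_field_derivative deriv k z) (at z)" if "k holomorphic_on UNIV" for k z
    using that by (intro holomorphic_derivI[of _ UNIV]) auto
  have holBg: "(\<lambda>z. B z * g z) holomorphic_on UNIV" by (intro holomorphic_intros hol)
  obtain x where x: "B x * g x \<noteq> 0"
    using nonzero_entire_mult[OF hol(2,4) B(2) g(2)] by blast
  let ?U = "{z. B z * g z \<noteq> 0}"
  have "(\<lambda>z. f z / g z * exp (A z / B z)) constant_on ?U"
  proof (rule has_field_derivative_0_imp_constant_on)
    show "connected ?U" using connected_nonzeros[OF holBg x] .
    show "open ?U" by (rule open_nonzeros[OF holBg])
    fix z assume "z \<in> ?U"
    then have nz: "B z \<noteq> 0" "g z \<noteq> 0" by auto
    have "((\<lambda>z. f z / g z * exp (A z / B z)) has_field_derivative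
       (deriv f z * g z - f z * deriv g z) / g z ^ 2 * exp (A z / B z) +
        f z / g z * (exp (A z / B z) * ((deriv A z * B z - A z * deriv B z) / B z ^ 2))) (at z)"
      using nz by (auto intro!: derivative_eq_intros der hol simp: field_simps power2_eq_square)
    also have "(deriv f z * g z - f z * deriv g z) / g z ^ 2 * exp (A z / B z) +
        f z / g z * (exp (A z / B z) * ((deriv A z * B z - A z * deriv B z) / B z ^ 2))
       = (g z * (deriv f z * B z ^ 2 + f z * (deriv A z * B z - A z * deriv B z))
          - f z * (deriv g z * B z ^ 2)) * (exp (A z / B z) / (g z ^ 2 * B z ^ 2))"
      using nz by (simp add: divide_simps) algebra
    also have "\<dots> = 0" using wronskian[of z] by simp
    finally show "((\<lambda>z. f z / g z * exp (A z / B z)) has_field_derivative 0) (at z)" .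
  qed
  then obtain \<kappa> where "\<And>z. z \<in> ?U \<Longrightarrow> f z / g z * exp (A z / B z) = \<kappa>"
    by (auto simp: constant_on_def)
  then have \<kappa>: "f z * exp (A z / B z) = \<kappa> * g z" if "B z * g z \<noteq> 0" for z
    using that by (auto simp: field_simps)
  \<comment> \<open>At a common non-zero of \<open>f\<close>, \<open>B\<close> and \<open>g\<close>
    the left side of \<open>\<kappa>\<close> is nonzero, so the constant is too.\<close>
  obtain y where "f y * (B y * g y) \<noteq> 0"
    using nonzero_entire_mult[OF hol(3) holBg f(2) x] by blast
  then have \<kappa>0: "\<kappa> \<noteq> 0" using \<kappa>[of y] by auto
  \<comment> \<open>The fraction is expanded by \<open>g\<close> so that its denominator is nonzero
    exactly on \<open>?U\<close>, where the identity \<open>\<kappa>\<close> is known.\<close>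
  obtain H where H: "H holomorphic_on UNIV" "\<And>z. B z * g z \<noteq> 0 \<Longrightarrow> H z = (A z * g z) / (B z * g z)"
  proof (rule entire_extension_of_log_quotient[of "\<lambda>z. A z * g z" "\<lambda>z. B z * g z" x f u "\<lambda>z. \<kappa> * g z" v])
    show "f z * exp (A z * g z / (B z * g z)) = \<kappa> * g z" if "B z * g z \<noteq> 0" for z
      using \<kappa>[OF that] that by simp
  qed (use hol f g x \<kappa>0 in \<open>auto intro!: holomorphic_intros\<close>)
  have AH: "A z = H z * B z" for z
    by (rule entire_eq_off_zeros[OF _ _ holBg x]) (use H hol in \<open>auto intro!: holomorphic_intros\<close>)
  have fH: "\<kappa> * g z = f z * exp (H z)" for z
    by (rule entire_eq_off_zeros[OF _ _ holBg x]) (use H hol \<kappa> in \<open>auto intro!: holomorphic_intros\<close>)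
  have "(\<lambda>z. \<kappa> * g z) \<in> entire_order_le \<rho>"
    using \<rho> g(1) by (intro entire_order_le_mult entire_order_le_const)
  then obtain P where "real (degree P) \<le> \<rho>" "\<And>z. H z = poly P z"
    using entire_quotient_exp_polynomial[OF _ f(1) H(1) \<rho> f(2) fH] by blast
  with AH show ?thesis using that by metis
qed

section \<open>Vanishing exponential sums\<close>

text \<open>Elimination as in the proof that exponentials are linearly independent. The exponents
  are kept and only the coefficients change from step to step, so the induction generalises over
  \<open>f\<close>.\<close>

lemma exp_quotient_sum_eq_0:
  assumes \<rho>: "\<rho> \<ge> 0" and B: "B \<in> entire_order_le \<rho>" "B w \<noteq> 0"
    and J: "finite J" "J \<noteq> {}" and A: "\<And>j. j \<in> J \<Longrightarrow> A j \<in> entire_order_le \<rho>"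
    and f: "\<And>j. j \<in> J \<Longrightarrow> f j \<in> entire_order_le \<rho>" "\<And>j. j \<in> J \<Longrightarrow> \<exists>z. f j z \<noteq> 0"
    and eq: "\<And>z. B z \<noteq> 0 \<Longrightarrow> (\<Sum>j\<in>J. f j z * exp (A j z / B z)) = 0"
  shows "\<exists>j\<in>J. \<exists>k\<in>J. j \<noteq> k \<and> (\<exists>P. real (degree P) \<le> \<rho> \<and> (\<forall>z. A j z - A k z = poly P z * B z))"
  using J A f eq
proof (induction J arbitrary: f rule: finite_ne_induct)
  case (singleton j)
  then obtain u where "f j u \<noteq> 0" by auto
  \<comment> \<open>A single term is nonzero at such a point, which contradicts the relation; no
    pair of indices has to be found.\<close>
  then obtain z where "f j z * B z \<noteq> 0"
    using nonzero_entire_mult[of "f j" B u w] singleton B entire_order_le_holomorphic by blast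
  then show ?case using singleton(4)[of z] by simp
next
  case (insert n J)
  have hol: "B holomorphic_on UNIV" "\<And>j. j \<in> insert n J \<Longrightarrow> A j holomorphic_on UNIV"
    "\<And>j. j \<in> insert n J \<Longrightarrow> f j holomorphic_on UNIV"
    using insert.prems(1,2) B(1) by (auto intro: entire_order_le_holomorphic)
  have der: "(k has_field_derivative deriv k z) (at z)" if "k holomorphic_on UNIV" for k z
    using that by (intro holomorphic_derivI[of _ UNIV]) auto
  \<comment> \<open>\<open>D j / B ^ 2\<close> is the coefficient of \<open>exp (A j / B)\<close> in
    the derivative of the \<open>j\<close>-th term; the factor \<open>B ^ 2\<close> makes it
    entire.\<close>
  define D where "D = (\<lambda>j z. deriv (f j) z * B z ^ 2 + f j z * (deriv (A j) z * B z - A j z * deriv B z))"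
  \<comment> \<open>Cross-multiplication makes \<open>g n\<close> zero, which removes term
    \<open>n\<close>. For other \<open>j\<close>, \<open>g j\<close> is the numerator of the
    derivative of the quotient of terms \<open>j\<close> and \<open>n\<close>, so it vanishes
    identically only for proportional terms.\<close>
  define g where "g = (\<lambda>j z. f n z * D j z - f j z * D n z)"
  show ?case
  proof (cases "\<forall>j\<in>J. \<exists>z. g j z \<noteq> 0")
    case True
    have D: "D j \<in> entire_order_le \<rho>" if "j \<in> insert n J" for j
      unfolding D_def using that \<rho> insert.prems B
      by (intro entire_order_le_add entire_order_le_diff entire_order_le_mult entire_order_le_power
          entire_order_le_deriv) auto
    have "\<exists>j\<in>J. \<exists>k\<in>J. j \<noteq> k \<and> (\<exists>P. real (degree P) \<le> \<rho> \<and> (\<forall>z. A j z - A k z = poly P z * B z))"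
    proof (rule insert.IH)
      show "A j \<in> entire_order_le \<rho>" if "j \<in> J" for j using that insert.prems by auto
      show "g j \<in> entire_order_le \<rho>" if "j \<in> J" for j
        unfolding g_def using that \<rho> insert.prems D
        by (intro entire_order_le_diff entire_order_le_mult) auto
      show "\<exists>z. g j z \<noteq> 0" if "j \<in> J" for j using that True by blast
      fix z assume z: "B z \<noteq> 0"
      have "((\<lambda>z. \<Sum>j\<in>insert n J. f j z * exp (A j z / B z)) has_field_derivative
          (\<Sum>j\<in>insert n J. D j z / B z ^ 2 * exp (A j z / B z))) (at z)"
      proof (rule DERIV_sum)
        fix j assume j: "j \<in> insert n J"
        have "((\<lambda>z. f j z * exp (A j z / B z)) has_field_derivative
            deriv (f j) z * exp (A j z / B z)
            + f j z * (exp (A j z / B z) * ((deriv (A j) z * B z - A j z * deriv B z) / B z ^ 2))) (at z)"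
          using z by (auto intro!: derivative_eq_intros der hol j simp: power2_eq_square)
        moreover have "deriv (f j) z * exp (A j z / B z)
            + f j z * (exp (A j z / B z) * ((deriv (A j) z * B z - A j z * deriv B z) / B z ^ 2))
            = D j z / B z ^ 2 * exp (A j z / B z)"
          using z by (simp add: D_def field_simps)
        ultimately show "((\<lambda>z. f j z * exp (A j z / B z)) has_field_derivative
            D j z / B z ^ 2 * exp (A j z / B z)) (at z)" by simp
      qed
      then have "((\<lambda>z. 0) has_field_derivative
          (\<Sum>j\<in>insert n J. D j z / B z ^ 2 * exp (A j z / B z))) (at z)"
        by (rule has_field_derivative_transform_within_open[OF _ open_nonzeros[OF hol(1)]])
           (use z insert.prems in auto)
      then have "(\<Sum>j\<in>insert n J. D j z / B z ^ 2 * exp (A j z / B z)) = 0"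
        by (rule DERIV_unique) simp
      then have "B z ^ 2 * (\<Sum>j\<in>insert n J. D j z / B z ^ 2 * exp (A j z / B z)) = 0" by simp
      then have D0: "(\<Sum>j\<in>insert n J. D j z * exp (A j z / B z)) = 0"
        unfolding sum_distrib_left using z by simp
      have "(\<Sum>j\<in>insert n J. g j z * exp (A j z / B z))
          = f n z * (\<Sum>j\<in>insert n J. D j z * exp (A j z / B z))
            - D n z * (\<Sum>j\<in>insert n J. f j z * exp (A j z / B z))"
        unfolding sum_distrib_left sum_subtractf[symmetric]
        by (intro sum.cong) (auto simp: g_def algebra_simps)
      also have "\<dots> = 0" unfolding D0 insert.prems(4)[OF z] by simp
      finally show "(\<Sum>j\<in>J. g j z * exp (A j z / B z)) = 0"
        using insert.hyps by (simp add: g_def)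
    qed
    then show ?thesis by blast
  next
    case False
    then obtain j where j: "j \<in> J" "\<And>z. g j z = 0" by blast
    obtain u where u: "f j u \<noteq> 0" using insert.prems(3)[of j] j(1) by auto
    obtain v where v: "f n v \<noteq> 0" using insert.prems(3)[of n] by auto
    \<comment> \<open>The equation \<open>g j z = 0\<close>, regrouped so that the exponents enter
      only through \<open>A j - A n\<close>.\<close>
    have wr: "f n z * (deriv (f j) z * B z ^ 2
          + f j z * (deriv (\<lambda>z. A j z - A n z) z * B z - (A j z - A n z) * deriv B z))
        = f j z * (deriv (f n) z * B z ^ 2)" for z
    proof -
      have d: "deriv (\<lambda>z. A j z - A n z) z = deriv (A j) z - deriv (A n) z"
        using j(1) by (intro DERIV_imp_deriv DERIV_diff der hol) auto
      show ?thesis using j(2)[of z] unfolding g_def D_def d by (simp add: algebra_simps)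
    qed
    have mem: "(\<lambda>z. A j z - A n z) \<in> entire_order_le \<rho>"
        "f j \<in> entire_order_le \<rho>" "f n \<in> entire_order_le \<rho>"
      using insert.prems(1,2) j(1) by (auto intro: entire_order_le_diff[OF \<rho>])
    obtain P where "real (degree P) \<le> \<rho>" "\<And>z. A j z - A n z = poly P z * B z"
      using quotient_polynomial_of_constant_exp_ratio[OF \<rho> mem(1) B mem(2) u mem(3) v wr] by blast
    moreover have "j \<noteq> n" using j(1) insert.hyps by auto
    ultimately show ?thesis using j(1) by blast
  qed
qed

section \<open>Reduction of the curve to a common denominator\<close>

text \<open>A monomial of total degree at most \<open>D\<close> becomes entire in \<open>t\<close>
  after multiplication by \<open>B t ^ D\<close>, as its denominator is a lower or equal power of
  \<open>B t\<close>.\<close>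

lemma cmpoly_eval_clear_denominators:
  assumes \<rho>: "\<rho> \<ge> 0" and B: "B \<in> entire_order_le \<rho>" and c: "\<And>i. c i \<in> entire_order_le \<rho>"
  shows "\<exists>E D. E \<in> entire_order_le \<rho> \<and>
    (\<forall>t. B t \<noteq> 0 \<longrightarrow> E t = B t ^ D * cmpoly_eval p (\<chi> i. c i t / B t))"
proof -
  define deg where "deg m = (\<Sum>i\<in>UNIV. Poly_Mapping.lookup m i)" for m :: "'a \<Rightarrow>\<^sub>0 nat"
  \<comment> \<open>A crude common bound for the degrees of the monomials; unlike a maximum, the sum
    is also meaningful for the zero polynomial.\<close>
  define D where "D = (\<Sum>m\<in>Poly_Mapping.keys p. deg m)"
  define E where "E t = (\<Sum>m\<in>Poly_Mapping.keys p. Poly_Mapping.lookup p m *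
      ((\<Prod>i\<in>UNIV. c i t ^ Poly_Mapping.lookup m i) * B t ^ (D - deg m)))" for t
  have "E \<in> entire_order_le \<rho>"
    unfolding E_def using \<rho> B c
    by (intro entire_order_le_sum entire_order_le_mult entire_order_le_const entire_order_le_prod
        entire_order_le_power)
  moreover have "E t = B t ^ D * cmpoly_eval p (\<chi> i. c i t / B t)" if t: "B t \<noteq> 0" for t
    unfolding E_def cmpoly_eval_def sum_distrib_left
  proof (rule sum.cong[OF refl])
    fix m assume "m \<in> Poly_Mapping.keys p"
    then have "deg m \<le> D" unfolding D_def by (intro member_le_sum) auto
    then have "B t ^ (D - deg m) = B t ^ D / B t ^ deg m" using t by (simp add: power_diff)
    moreover have "(\<Prod>i\<in>UNIV. (c i t / B t) ^ Poly_Mapping.lookup m i)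
        = (\<Prod>i\<in>UNIV. c i t ^ Poly_Mapping.lookup m i) / B t ^ deg m"
      by (simp add: power_divide prod_dividef power_sum deg_def)
    ultimately show "Poly_Mapping.lookup p m *
        ((\<Prod>i\<in>UNIV. c i t ^ Poly_Mapping.lookup m i) * B t ^ (D - deg m))
      = B t ^ D * (Poly_Mapping.lookup p m *
        (\<Prod>i\<in>UNIV. ((\<chi> i. c i t / B t) $ i) ^ Poly_Mapping.lookup m i))"
      by simp
  qed
  ultimately show ?thesis by blast
qed

theorem theorem3p1:
  fixes N :: nat
    and v :: "nat \<Rightarrow> real ^ 'd::finite"
    and p q :: "nat \<Rightarrow> 'd cmpoly"
    and a b :: "'d \<Rightarrow> complex \<Rightarrow> complex"
    and \<rho> :: real
  assumes "CARD('d) \<ge> 2"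
    and "N \<ge> 1"
    and "inj_on v {1..N}"
    and "\<And>i. a i holomorphic_on UNIV"
    and "\<And>i. b i holomorphic_on UNIV"
    and "\<And>i. growth_order (a i) < \<infinity>"
    and "\<And>i. growth_order (b i) < \<infinity>"
    and "\<And>i. \<exists>t. b i t \<noteq> 0"
    and "ereal \<rho> = Max (growth_order ` (range a \<union> range b))"
    and "\<And>j. j \<in> {1..N} \<Longrightarrow>
           \<not> vanishes_identically (curve_defined b) (\<lambda>t. cmpoly_eval (p j) (curve a b t))"
    and "\<And>j. j \<in> {1..N} \<Longrightarrow>
           \<not> vanishes_identically (curve_defined b) (\<lambda>t. cmpoly_eval (q j) (curve a b t))"
  shows "finite {t::real. 0 \<le> t \<and> t \<le> 1 \<and>
            \<not> (curve_defined b (complex_of_real t) \<and>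
                exp_sum_defined N p (curve a b (complex_of_real t)))}
    \<and> (vanishes_identically
           (\<lambda>t. curve_defined b t \<and> exp_sum_defined N p (curve a b t))
           (\<lambda>t. exp_sum N v p q (curve a b t))
        \<longrightarrow> (\<exists>w :: complex ^ 'd. w \<noteq> 0 \<and>
              (\<exists>P :: complex poly. real (degree P) \<le> \<rho> \<and>
                 (\<forall>t::complex. curve_defined b t \<longrightarrow> cdot w (curve a b t) = poly P t))))"
proof -
  have \<rho>_upper: "growth_order (a i) \<le> ereal \<rho>" "growth_order (b i) \<le> ereal \<rho>" for i
    unfolding assms(9) by (intro Max_ge; simp)+
  have \<rho>: "\<rho> \<ge> 0"
    using order_trans[OF growth_order_nonneg \<rho>_upper(1)] by simp
  have a: "a i \<in> entire_order_le \<rho>" and b: "b i \<in> entire_order_le \<rho>" for i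
    using assms(4,5) \<rho>_upper by (auto intro: entire_order_le_growth_order)
  \<comment> \<open>All coordinates of the curve are put over the one denominator \<open>B\<close>,
    with numerators \<open>c i\<close>.\<close>
  define B where "B t = (\<Prod>i\<in>UNIV. b i t)" for t
  define c where "c i t = a i t * (\<Prod>k\<in>UNIV - {i}. b k t)" for i t
  have B: "B \<in> entire_order_le \<rho>" unfolding B_def using \<rho> b by (intro entire_order_le_prod)
  have c: "c i \<in> entire_order_le \<rho>" for i
    unfolding c_def using \<rho> a b by (intro entire_order_le_mult entire_order_le_prod)
  have B_iff: "B t \<noteq> 0 \<longleftrightarrow> curve_defined b t" for t by (simp add: B_def curve_defined_def)
  have curve_eq: "curve a b t = (\<chi> i. c i t / B t)" if t: "B t \<noteq> 0" for t
  proof -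
    have "a i t / b i t = c i t / B t" for i
    proof -
      have "B t = b i t * (\<Prod>k\<in>UNIV - {i}. b k t)"
        unfolding B_def by (rule prod.remove) auto
      then show ?thesis using t by (simp add: c_def)
    qed
    then show ?thesis by (simp add: curve_def)
  qed
  have "\<forall>r::'d cmpoly. \<exists>E D. E \<in> entire_order_le \<rho> \<and>
      (\<forall>t. B t \<noteq> 0 \<longrightarrow> E t = B t ^ D * cmpoly_eval r (\<chi> i. c i t / B t))"
    using cmpoly_eval_clear_denominators[OF \<rho> B, of c] c by blast
  then obtain E D where E: "\<And>r::'d cmpoly. E r \<in> entire_order_le \<rho>"
      "\<And>r t. B t \<noteq> 0 \<Longrightarrow> E r t = B t ^ D r * cmpoly_eval r (\<chi> i. c i t / B t)"
    by metis
  \<comment> \<open>The powers of \<open>B\<close> are exchanged so that \<open>P j\<close> and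
    \<open>Q j\<close> carry the same one, and \<open>Q j / P j\<close> is the original quotient
    along the curve.\<close>
  define P where "P j t = E (p j) t * B t ^ D (q j)" for j t
  define Q where "Q j t = E (q j) t * B t ^ D (p j)" for j t
  have P_eq: "P j t = B t ^ (D (p j) + D (q j)) * cmpoly_eval (p j) (curve a b t)"
    and Q_eq: "Q j t = B t ^ (D (p j) + D (q j)) * cmpoly_eval (q j) (curve a b t)"
    if "B t \<noteq> 0" for j t
    using E(2)[OF that] curve_eq[OF that] by (simp_all add: P_def Q_def power_add)
  have P: "P j \<in> entire_order_le \<rho>" and Q: "Q j \<in> entire_order_le \<rho>" for j
    unfolding P_def Q_def using \<rho> E B by (intro entire_order_le_mult entire_order_le_power; simp)+
  have P0: "\<exists>t. P j t \<noteq> 0" if j: "j \<in> {1..N}" for j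
  proof -
    obtain t where "B t \<noteq> 0" "cmpoly_eval (p j) (curve a b t) \<noteq> 0"
      using assms(10)[OF j] B_iff by (auto simp: vanishes_identically_def)
    then have "P j t \<noteq> 0" using P_eq[of t j] by simp
    then show ?thesis ..
  qed
  have Q0: "\<exists>t. Q j t \<noteq> 0" if j: "j \<in> {1..N}" for j
  proof -
    obtain t where "B t \<noteq> 0" "cmpoly_eval (q j) (curve a b t) \<noteq> 0"
      using assms(11)[OF j] B_iff by (auto simp: vanishes_identically_def)
    then have "Q j t \<noteq> 0" using Q_eq[of t j] by simp
    then show ?thesis ..
  qed
  have B0: "\<exists>t. B t \<noteq> 0"
    unfolding B_def using assms(5,8) by (intro nonzero_entire_prod) auto
  then obtain w where w: "B w \<noteq> 0" ..
  \<comment> \<open>An entire function whose zeros are exactly the points where the exponential sum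
    is undefined; it has finitely many on a compact segment.\<close>
  define Z where "Z t = B t * (\<Prod>j\<in>{1..N}. P j t)" for t
  have Z: "Z \<in> entire_order_le \<rho>"
    unfolding Z_def using \<rho> B P by (intro entire_order_le_mult entire_order_le_prod)
  obtain u where u: "(\<Prod>j\<in>{1..N}. P j u) \<noteq> 0"
    using nonzero_entire_prod[of "{1..N}" P] P P0 entire_order_le_holomorphic by blast
  have "\<exists>z. Z z \<noteq> 0"
    unfolding Z_def
    using w u entire_order_le_holomorphic[OF B] entire_order_le_holomorphic[OF P]
    by (intro nonzero_entire_mult[of B "\<lambda>z. \<Prod>j\<in>{1..N}. P j z" w u] holomorphic_on_prod)
  then obtain x where x: "Z x \<noteq> 0" ..
  have Z_iff: "Z t \<noteq> 0 \<longleftrightarrow> curve_defined b t \<and> exp_sum_defined N p (curve a b t)" for t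
    using P_eq[of t] by (cases "B t = 0") (auto simp: Z_def B_iff[symmetric] exp_sum_defined_def)
  let ?I = "complex_of_real ` {0..1}"
  have fin: "finite {z \<in> ?I. Z z = 0}"
    using entire_order_le_holomorphic[OF Z] x
    by (intro finite_zeros_compact compact_continuous_image continuous_intros) auto
  have "finite (complex_of_real -` {z \<in> ?I. Z z = 0})"
    using fin by (rule finite_vimageI) (simp add: inj_of_real)
  then have finite: "finite {t::real. 0 \<le> t \<and> t \<le> 1 \<and>
            \<not> (curve_defined b (complex_of_real t) \<and>
                exp_sum_defined N p (curve a b (complex_of_real t)))}"
    by (rule finite_subset[rotated]) (use Z_iff in auto)
  define A where "A j t = (\<Sum>i\<in>UNIV. (- 2 * complex_of_real pi * \<i> * complex_of_real (v j $ i)) * c i t)" for j t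
  have A: "A j \<in> entire_order_le \<rho>" for j
    unfolding A_def using \<rho> c by (intro entire_order_le_sum entire_order_le_mult entire_order_le_const)
  have A_eq: "A j t / B t = - 2 * complex_of_real pi * \<i> * cdot (cvec (v j)) (curve a b t)"
    if "B t \<noteq> 0" for j t
    unfolding curve_eq[OF that]
    by (simp add: A_def cdot_def cvec_def sum_distrib_left sum_divide_distrib sum_negf mult.assoc)
  \<comment> \<open>The coefficients after multiplying the sum by all \<open>P k\<close>; this makes
    them entire.\<close>
  define f where "f j t = Q j t * (\<Prod>k\<in>{1..N} - {j}. P k t)" for j t
  have f: "f j \<in> entire_order_le \<rho>" for j
    unfolding f_def using \<rho> Q P by (intro entire_order_le_mult entire_order_le_prod)
  have f0: "\<exists>z. f j z \<noteq> 0" if j: "j \<in> {1..N}" for j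
  proof -
    obtain y where y: "(\<Prod>k\<in>{1..N} - {j}. P k y) \<noteq> 0"
      using nonzero_entire_prod[of "{1..N} - {j}" P] P P0 entire_order_le_holomorphic by blast
    obtain z where z: "Q j z \<noteq> 0" using Q0[OF j] ..
    show ?thesis unfolding f_def
      using z y entire_order_le_holomorphic[OF Q] entire_order_le_holomorphic[OF P]
      by (intro nonzero_entire_mult[of "Q j" "\<lambda>z. \<Prod>k\<in>{1..N} - {j}. P k z" z y] holomorphic_on_prod)
  qed
  have f_sum: "(\<Sum>j\<in>{1..N}. f j t * exp (A j t / B t))
      = (\<Prod>k\<in>{1..N}. P k t) * exp_sum N v p q (curve a b t)" if t: "Z t \<noteq> 0" for t
    unfolding exp_sum_def sum_distrib_left
  proof (rule sum.cong[OF refl])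
    fix j assume j: "j \<in> {1..N}"
    have Bt: "B t \<noteq> 0" and Pt: "P j t \<noteq> 0" using t j by (auto simp: Z_def)
    have "(\<Prod>k\<in>{1..N}. P k t) = P j t * (\<Prod>k\<in>{1..N} - {j}. P k t)"
      using j by (intro prod.remove) auto
    moreover have "Q j t = P j t * (cmpoly_eval (q j) (curve a b t) / cmpoly_eval (p j) (curve a b t))"
      using Pt by (simp add: P_eq[OF Bt] Q_eq[OF Bt])
    ultimately show "f j t * exp (A j t / B t) = (\<Prod>k\<in>{1..N}. P k t) *
        (cmpoly_eval (q j) (curve a b t) / cmpoly_eval (p j) (curve a b t) *
         exp (- 2 * complex_of_real pi * \<i> * cdot (cvec (v j)) (curve a b t)))"
      unfolding A_eq[OF Bt] f_def by simp
  qed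
  have "\<exists>w :: complex ^ 'd. w \<noteq> 0 \<and> (\<exists>P :: complex poly. real (degree P) \<le> \<rho> \<and>
          (\<forall>t::complex. curve_defined b t \<longrightarrow> cdot w (curve a b t) = poly P t))"
    if van: "vanishes_identically (\<lambda>t. curve_defined b t \<and> exp_sum_defined N p (curve a b t))
           (\<lambda>t. exp_sum N v p q (curve a b t))"
  proof -
    \<comment> \<open>The segment is infinite and \<open>Z\<close> has finitely many zeros on it, so
      the sum is defined at some point \<open>\<xi>\<close> of it.\<close>
    have "\<not> ?I \<subseteq> {z \<in> ?I. Z z = 0}"
    proof
      assume "?I \<subseteq> {z \<in> ?I. Z z = 0}"
      then have "finite ?I" using fin finite_subset by blast
      then have "finite {0..1::real}" by (rule finite_imageD) (auto intro: inj_onI)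
      then show False using infinite_Icc[of "0::real" 1] by simp
    qed
    then obtain \<xi> where \<xi>: "\<xi> \<in> ?I" "Z \<xi> \<noteq> 0" by blast
    \<comment> \<open>A connected set with more than one point has no isolated points; as
      \<open>Z\<close> is nonzero near \<open>\<xi>\<close>, points where the sum is defined
      accumulate at \<open>\<xi>\<close>.\<close>
    have "connected ?I" by (intro connected_continuous_image continuous_intros) auto
    moreover have "\<nexists>y. ?I = {y}"
    proof
      assume "\<exists>y. ?I = {y}"
      then obtain y where "?I = {y}" ..
      moreover have "0 \<in> ?I" "1 \<in> ?I" by (auto intro: image_eqI[of _ _ 0] image_eqI[of _ _ 1])
      ultimately show False by auto
    qed
    ultimately have lim: "\<xi> islimpt ?I" using \<xi>(1) by (intro connected_imp_perfect) auto
    have openZ: "open {z. Z z \<noteq> 0}" using entire_order_le_holomorphic[OF Z] by (rule open_nonzeros)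
    have "\<xi> islimpt ?I \<inter> {z. Z z \<noteq> 0}"
    proof (rule islimptI)
      fix T assume "\<xi> \<in> T" "open T"
      then have "\<xi> \<in> T \<inter> {z. Z z \<noteq> 0}" "open (T \<inter> {z. Z z \<noteq> 0})"
        using \<xi>(2) openZ by auto
      from islimptE[OF lim this] show "\<exists>y\<in>?I \<inter> {z. Z z \<noteq> 0}. y \<in> T \<and> y \<noteq> \<xi>" by blast
    qed
    \<comment> \<open>The identity theorem spreads the relation from the segment to the connected
      open set where \<open>B\<close> is nonzero, including zeros of the \<open>P j\<close>.\<close>
    have zero: "(\<Sum>j\<in>{1..N}. f j z * exp (A j z / B z)) = 0" if z: "B z \<noteq> 0" for z
    proof (rule analytic_continuation[where
          f = "\<lambda>z. \<Sum>j\<in>{1..N}. f j z * exp (A j z / B z)" and S = "{z. B z \<noteq> 0}" and U = "?I \<inter> {z. Z z \<noteq> 0}" and \<xi> = \<xi>])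
      show "(\<lambda>z. \<Sum>j\<in>{1..N}. f j z * exp (A j z / B z)) holomorphic_on {z. B z \<noteq> 0}"
        by (intro holomorphic_intros entire_order_le_holomorphic[OF f]
            entire_order_le_holomorphic[OF A] entire_order_le_holomorphic[OF B]) auto
      show "open {z. B z \<noteq> 0}" by (rule open_nonzeros[OF entire_order_le_holomorphic[OF B]])
      show "connected {z. B z \<noteq> 0}" by (rule connected_nonzeros[OF entire_order_le_holomorphic[OF B] w])
      show "?I \<inter> {z. Z z \<noteq> 0} \<subseteq> {z. B z \<noteq> 0}" by (auto simp: Z_def)
      show "\<xi> \<in> {z. B z \<noteq> 0}" using \<xi>(2) by (auto simp: Z_def)
      show "\<xi> islimpt ?I \<inter> {z. Z z \<noteq> 0}" by fact
      show "z \<in> {z. B z \<noteq> 0}" using z by simp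
      fix y assume y: "y \<in> ?I \<inter> {z. Z z \<noteq> 0}"
      then obtain t where t: "0 \<le> t" "t \<le> 1" "y = complex_of_real t" by auto
      have Zy: "Z y \<noteq> 0" using y by simp
      then have "exp_sum N v p q (curve a b y) = 0"
        using van t Z_iff[of y] by (auto simp: vanishes_identically_def)
      then show "(\<Sum>j\<in>{1..N}. f j y * exp (A j y / B y)) = 0" using f_sum[OF Zy] by simp
    qed
    have "{1..N} \<noteq> {}" using assms(2) by simp
    from exp_quotient_sum_eq_0[OF \<rho> B w finite_atLeastAtMost this A f f0 zero]
    obtain j k R where jk: "j \<in> {1..N}" "k \<in> {1..N}" "j \<noteq> k" and R: "real (degree R) \<le> \<rho>"
        "\<And>z. A j z - A k z = poly R z * B z"
      by blast
    \<comment> \<open>The coefficient vector of \<open>(A j - A k) / B\<close> in terms of the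
      curve; it is nonzero because the points \<open>v j\<close> and \<open>v k\<close> are
      distinct.\<close>
    define s where "s = (\<chi> i. - 2 * complex_of_real pi * \<i> * complex_of_real (v j $ i - v k $ i))"
    have "v j \<noteq> v k" using assms(3) jk by (auto dest: inj_onD)
    then obtain i where "v j $ i \<noteq> v k $ i" by (auto simp: vec_eq_iff)
    then have "s $ i \<noteq> 0" by (simp add: s_def)
    then have "s \<noteq> 0" by auto
    moreover have "cdot s (curve a b t) = poly R t" if "curve_defined b t" for t
    proof -
      have Bt: "B t \<noteq> 0" using that B_iff by simp
      have "cdot s (curve a b t) = A j t / B t - A k t / B t"
        unfolding A_eq[OF Bt] cdot_def sum_distrib_left sum_subtractf[symmetric]
        by (intro sum.cong) (auto simp: s_def cvec_def algebra_simps)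
      also have "\<dots> = poly R t" using R(2)[of t] Bt by (simp add: diff_divide_distrib[symmetric])
      finally show ?thesis .
    qed
    ultimately show ?thesis using R(1) by blast
  qed
  then show ?thesis using finite by blast
qed

end
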